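(* Let $X$ be an infinite-dimensional real Banach space, $I=[0,a]$ with $a>0$, $\mu$ a convex measure of noncompactness on $X$, $x_0\in X$, $r>0$, and $B(x_0,r)=\{x\in X:\|x-x_0\|\le r\}$. Let $a_1=\min\{1,a\}$. Suppose that $f:[0,a]\times B(x_0,r)\to X$ is uniformly continuous and $w$ is a Kamke comparison function. If $f$ is bounded (in norm) on $[0,a]\times B(x_0,r)$ by $\xi$ with $0\le\xi\le r$, and if for all nonempty $B\subset B(x_0,r)$ and almost all $t\in[0,a_1]$ $$\mu(f(t,B))\le w(t,\mu(B)),$$ then the Cauchy problem $$x'(t)=f(t,x),\ \ 0<t\le a,\qquad x(0)=x_0$$ has at least one solution $x\in C([0,a_1],X)$ (on the interval $[0,a_1]$). In particular, if $\mu$ is a sublinear measure of noncompactness, then one may take $a_1=a$, i.e. the Cauchy problem has at least one solution $x\in C([0,a],X)$.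
   Context: $\mathcal B(X)$ is the set of nonempty bounded subsets of $X$. A convex measure of noncompactness on $X$ is a function $\mu:\mathcal B(X)\to[0,\infty)$ such that for all $A,B\in\mathcal B(X)$: (1) $\mu(B)=0$ iff $B$ is relatively compact; (2) $A\supset B$ implies $\mu(A)\ge\mu(B)$; (3) $\mu({\rm co}(B))=\mu(B)$; (4) $\mu(\lambda A+(1-\lambda)B)\le\lambda\mu(A)+(1-\lambda)\mu(B)$ for $0\le\lambda\le1$. A sublinear measure of noncompactness is a function satisfying (1), (2), (3) together with $\mu(A+B)\le\mu(A)+\mu(B)$ and $\mu(kB)=k\mu(B)$ for all $k\ge0$. Here $f(t,B)=\{f(t,x):x\in B\}$. A Kamke comparison function is a real nonnegative function $w(t,u)$ on $(0,a]\times[0,+\infty)$, continuous in $u$ for each fixed $t$ and measurable in $t$ for each fixed $u$, such that $w(t,0)=0$ and the constant function $u=0$ is the unique solution of the integral inequality $u(t)\le\int_0^tw(s,u(s))\,ds$, $t\in(0,a]$, satisfying $\lim_{t\to0^+}u(t)/t=\lim_{t\to0^+}u(t)=0$.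
   Formalization: In the sublinear case the condition ξa ≤ r is added: with a=2, f constant of norm r=ξ, w=0, the only candidate x0+tv leaves B(x0,r) after t=1. The Kamke integral is taken with values in [0,∞]. *)

theory Defs
  imports "HOL-Analysis.Analysis"
begin

text \<open>Measures of noncompactness are total functions on sets here; every condition is
  restricted to nonempty bounded sets, so the values elsewhere are irrelevant.\<close>

definition bdd_sets :: "'a::real_normed_vector set set" where
  "bdd_sets = {B. B \<noteq> {} \<and> bounded B}"

definition mnc_base :: "('a::real_normed_vector set \<Rightarrow> real) \<Rightarrow> bool" where
  "mnc_base \<mu> \<longleftrightarrow>
     (\<forall>B\<in>bdd_sets. 0 \<le> \<mu> B) \<and>
     (\<forall>B\<in>bdd_sets. \<mu> B = 0 \<longleftrightarrow> compact (closure B)) \<and>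
     (\<forall>A\<in>bdd_sets. \<forall>B\<in>bdd_sets. B \<subseteq> A \<longrightarrow> \<mu> B \<le> \<mu> A) \<and>
     (\<forall>B\<in>bdd_sets. \<mu> (convex hull B) = \<mu> B)"

definition convex_mnc :: "('a::real_normed_vector set \<Rightarrow> real) \<Rightarrow> bool" where
  "convex_mnc \<mu> \<longleftrightarrow> mnc_base \<mu> \<and>
     (\<forall>A\<in>bdd_sets. \<forall>B\<in>bdd_sets. \<forall>l::real. 0 \<le> l \<and> l \<le> 1 \<longrightarrow>
        \<mu> {l *\<^sub>R x + (1 - l) *\<^sub>R y | x y. x \<in> A \<and> y \<in> B} \<le> l * \<mu> A + (1 - l) * \<mu> B)"

definition sublinear_mnc :: "('a::real_normed_vector set \<Rightarrow> real) \<Rightarrow> bool" where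
  "sublinear_mnc \<mu> \<longleftrightarrow> mnc_base \<mu> \<and>
     (\<forall>A\<in>bdd_sets. \<forall>B\<in>bdd_sets. \<mu> {x + y | x y. x \<in> A \<and> y \<in> B} \<le> \<mu> A + \<mu> B) \<and>
     (\<forall>B\<in>bdd_sets. \<forall>k::real. 0 \<le> k \<longrightarrow> \<mu> ((\<lambda>x. k *\<^sub>R x) ` B) = k * \<mu> B)"

text \<open>The competitors \<open>u\<close> are nonnegative (the second argument of \<open>w\<close> ranges over
  \<open>[0, \<infinity>)\<close>) and continuous. The integral of the nonnegative measurable function
  \<open>s \<mapsto> w s (u s)\<close> is the Lebesgue integral with values in \<open>[0, \<infinity>]\<close>, so the
  inequality holds trivially where the integral diverges.\<close>

definition kamke_solution :: "real \<Rightarrow> (real \<Rightarrow> real \<Rightarrow> real) \<Rightarrow> (real \<Rightarrow> real) \<Rightarrow> bool" where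
  "kamke_solution a w u \<longleftrightarrow>
     (\<forall>t\<in>{0<..a}. 0 \<le> u t) \<and> continuous_on {0<..a} u \<and>
     (\<forall>t\<in>{0<..a}. ennreal (u t) \<le> (\<integral>\<^sup>+s\<in>{0<..t}. ennreal (w s (u s)) \<partial>lebesgue)) \<and>
     ((\<lambda>t. u t / t) \<longlongrightarrow> 0) (at_right 0) \<and> (u \<longlongrightarrow> 0) (at_right 0)"

definition kamke_function :: "real \<Rightarrow> (real \<Rightarrow> real \<Rightarrow> real) \<Rightarrow> bool" where
  "kamke_function a w \<longleftrightarrow>
     (\<forall>t\<in>{0<..a}. \<forall>u\<ge>0. 0 \<le> w t u) \<and>
     (\<forall>t\<in>{0<..a}. continuous_on {0..} (w t)) \<and>
     (\<forall>u\<ge>0. (\<lambda>t. w t u) \<in> borel_measurable (lebesgue_on {0<..a})) \<and>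
     (\<forall>t\<in>{0<..a}. w t 0 = 0) \<and>
     (\<forall>u. kamke_solution a w u \<longrightarrow> (\<forall>t\<in>{0<..a}. u t = 0))"

text \<open>A solution of \<open>x' = f(t,x)\<close>, \<open>x(0) = x0\<close> on \<open>[0,b]\<close> for a right-hand side
  given only on \<open>[0,b] \<times> D\<close>; it therefore has to stay in \<open>D\<close>. The derivative at the
  endpoint \<open>b\<close> is one-sided.\<close>

definition cauchy_solution ::
    "(real \<Rightarrow> 'a \<Rightarrow> 'a) \<Rightarrow> 'a set \<Rightarrow> 'a::real_normed_vector \<Rightarrow> real \<Rightarrow> (real \<Rightarrow> 'a) \<Rightarrow> bool" where
  "cauchy_solution f D x0 b x \<longleftrightarrow>
     continuous_on {0..b} x \<and> x 0 = x0 \<and> (\<forall>t\<in>{0..b}. x t \<in> D) \<and>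
     (\<forall>t\<in>{0<..b}. (x has_vector_derivative f t (x t)) (at t within {0..b}))"

end

(* Solutions x_n of Tonelli's delayed integral equations exist, are equi-Lipschitz and stay in the ball. Put
   u t = mu {x_n t : n} and h t = mu {f t (x_n t) : n}. A convex measure of noncompactness is stable under small
   uniform perturbations and under addition of a relatively compact sequence; hence u and h are continuous, the delay
   does not matter, and convexity applied to Riemann sums yields u t <= integral of h over [0,t]. As h 0 = 0, this
   gives u t / t --> 0, and h t <= w t (u t) almost everywhere makes u a Kamke competitor, so u = 0. Thus the x_n are
   pointwise relatively compact, and a cluster point solves the Cauchy problem. *)

theory Submission
  imports Defs
begin

text \<open>Convexity alone gives neither subadditivity nor homogeneity of \<open>\<mu>\<close>, so
  an error cannot be split off as a small summand. It is hidden in a convex combination instead: an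
  error of norm at most \<open>e\<close> is divided by \<open>e\<close> and returns with weight
  \<open>e\<close>, at the cost of \<open>e\<close> times the measure of a fixed ball. For the same
  reason only averages of values can be estimated. The integral over \<open>[0, t]\<close> is
  \<open>t\<close> times an average, up to a small error, and pulling out this factor is the one
  step where convex and sublinear measures are treated differently; the hypothesis
  \<open>scale\<close> isolates it, so that both cases share one proof.\<close>

section \<open>Stability properties of convex measures of noncompactness\<close>

lemma convex_mncD:
  assumes "convex_mnc \<mu>"
  shows convex_mnc_nonneg: "\<And>B. B \<noteq> {} \<Longrightarrow> bounded B \<Longrightarrow> 0 \<le> \<mu> B"
    and convex_mnc_eq_0_iff: "\<And>B. B \<noteq> {} \<Longrightarrow> bounded B \<Longrightarrow> \<mu> B = 0 \<longleftrightarrow> compact (closure B)"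
    and convex_mnc_mono: "\<And>A B. B \<noteq> {} \<Longrightarrow> bounded A \<Longrightarrow> B \<subseteq> A \<Longrightarrow> \<mu> B \<le> \<mu> A"
    and convex_mnc_convex: "\<And>A B l. A \<noteq> {} \<Longrightarrow> bounded A \<Longrightarrow> B \<noteq> {} \<Longrightarrow> bounded B \<Longrightarrow> 0 \<le> l \<Longrightarrow> l \<le> 1
      \<Longrightarrow> \<mu> {l *\<^sub>R x + (1 - l) *\<^sub>R y | x y. x \<in> A \<and> y \<in> B} \<le> l * \<mu> A + (1 - l) * \<mu> B"
  using assms unfolding convex_mnc_def mnc_base_def bdd_sets_def
  by (blast intro: bounded_subset)+

lemma bounded_convex_combination:
  fixes A B :: "'a::real_normed_vector set"
  assumes "bounded A" "bounded B"
  shows "bounded {k *\<^sub>R x + l *\<^sub>R y | x y. x \<in> A \<and> y \<in> B}"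
proof -
  have "bounded ((*\<^sub>R) k ` A)" "bounded ((*\<^sub>R) l ` B)"
    using assms by (auto intro: bounded_scaling)
  from bounded_plus[OF this] show ?thesis
    by (rule bounded_subset) auto
qed

text \<open>Both families carry the same index, so the new range is only the diagonal part of the
  convex combination of the two ranges, and monotonicity applies. Later uses of convexity all go
  through this indexed form.\<close>

lemma convex_mnc_range_convex:
  assumes "convex_mnc \<mu>" "bounded (range p)" "bounded (range q)" "0 \<le> l" "l \<le> 1"
  shows "\<mu> (range (\<lambda>i. l *\<^sub>R p i + (1 - l) *\<^sub>R q i)) \<le> l * \<mu> (range p) + (1 - l) * \<mu> (range q)"
proof -
  let ?C = "{l *\<^sub>R x + (1 - l) *\<^sub>R y | x y. x \<in> range p \<and> y \<in> range q}"
  have "\<mu> (range (\<lambda>i. l *\<^sub>R p i + (1 - l) *\<^sub>R q i)) \<le> \<mu> ?C"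
    using assms(2,3) by (intro convex_mnc_mono[OF assms(1)] bounded_convex_combination) auto
  also have "\<dots> \<le> l * \<mu> (range p) + (1 - l) * \<mu> (range q)"
    using assms by (intro convex_mnc_convex[OF assms(1)]) auto
  finally show ?thesis .
qed

text \<open>\<open>q = (1 - e) p + e (p + (q - p) / e)\<close>, and the second family stays in a fixed ball.\<close>

lemma convex_mnc_perturb:
  fixes p q :: "'i \<Rightarrow> 'a::real_normed_vector"
  assumes mu: "convex_mnc \<mu>" and p: "\<And>i. norm (p i) \<le> M"
    and pq: "\<And>i. norm (q i - p i) \<le> e" and e: "0 < e" "e \<le> 1"
  shows "\<mu> (range q) \<le> \<mu> (range p) + e * \<mu> (cball 0 (M + 1))"
proof -
  define z where "z i = p i + (1 / e) *\<^sub>R (q i - p i)" for i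
  have z: "norm (z i) \<le> M + 1" for i
  proof -
    have "norm (z i) \<le> norm (p i) + norm (q i - p i) / e"
      unfolding z_def using norm_triangle_ineq[of "p i" "(1 / e) *\<^sub>R (q i - p i)"] e by simp
    also have "\<dots> \<le> M + 1"
      using p[of i] pq[of i] e by (intro add_mono) (auto simp: divide_simps)
    finally show ?thesis .
  qed
  have bp: "bounded (range p)" using p by (auto simp: bounded_iff)
  have bz: "bounded (range z)" using z by (auto simp: bounded_iff)
  have "q = (\<lambda>i. e *\<^sub>R z i + (1 - e) *\<^sub>R p i)"
    using e by (auto simp: z_def algebra_simps)
  hence "\<mu> (range q) \<le> e * \<mu> (range z) + (1 - e) * \<mu> (range p)"
    using convex_mnc_range_convex[OF mu bz bp, of e] e by simp
  also have "\<dots> \<le> e * \<mu> (cball 0 (M + 1)) + 1 * \<mu> (range p)"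
    using e z bp convex_mnc_nonneg[OF mu _ bp]
    by (intro add_mono mult_mono convex_mnc_mono[OF mu] convex_mnc_nonneg[OF mu _ bz]) auto
  finally show ?thesis by simp
qed

text \<open>Absorbs constants: an error bound \<open>e * K\<close> with fixed \<open>K\<close>
  suffices. The restriction \<open>e \<le> 1\<close> matches that of
  \<open>convex_mnc_perturb\<close>.\<close>

lemma le_if_le_add_mult_small:
  fixes x y K :: real
  assumes "\<And>e. 0 < e \<Longrightarrow> e \<le> 1 \<Longrightarrow> x \<le> y + e * K"
  shows "x \<le> y"
proof (rule tendsto_lowerbound[where F = "at_right (0::real)"])
  show "((\<lambda>e. y + e * K) \<longlongrightarrow> y) (at_right 0)" by (auto intro!: tendsto_eq_intros)
  show "\<forall>\<^sub>F e in at_right 0. x \<le> y + e * K"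
    unfolding eventually_at_right_field by (rule exI[of _ 1]) (use assms in auto)
qed simp

text \<open>Write \<open>p + e = (1 - l) (p / (1 - l)) + l (e / l)\<close>, where the second family has measure zero and the first
  tends to \<open>p\<close> uniformly as \<open>l\<close> tends to zero.\<close>

lemma convex_mnc_add_compact:
  fixes p e :: "'i \<Rightarrow> 'a::real_normed_vector"
  assumes mu: "convex_mnc \<mu>" and p: "bounded (range p)" and e: "compact (closure (range e))"
  shows "\<mu> (range (\<lambda>i. p i + e i)) \<le> \<mu> (range p)"
proof -
  obtain M where M: "0 < M" "\<And>i. norm (p i) \<le> M"
    using p by (auto simp: bounded_pos)
  define C where "C = \<mu> (cball (0::'a) (M + 1))"
  \<comment> \<open>\<open>l \<le> 1 / 2\<close> gives \<open>l / (1 - l) \<le> 2 * l\<close>, so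
    dividing \<open>p\<close> by \<open>1 - l\<close> moves it by at most \<open>2 * l * M\<close>;
    \<open>convex_mnc_perturb\<close> accepts this size if it is at most 1.\<close>
  have key: "\<mu> (range (\<lambda>i. p i + e i)) \<le> \<mu> (range p) + (2 * l * M) * C"
    if l: "0 < l" "l \<le> 1 / 2" "2 * l * M \<le> 1" for l
  proof -
    let ?p = "\<lambda>i. (1 / (1 - l)) *\<^sub>R p i" and ?e = "\<lambda>i. (1 / l) *\<^sub>R e i"
    have "norm (?p i - p i) \<le> 2 * l * M" for i
    proof -
      have "?p i - p i = (1 / (1 - l) - 1) *\<^sub>R p i" by (simp only: scaleR_diff_left scaleR_one)
      also have "1 / (1 - l) - 1 = l / (1 - l)" using l by (simp add: field_simps)
      finally have "?p i - p i = (l / (1 - l)) *\<^sub>R p i" .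
      hence "norm (?p i - p i) = l / (1 - l) * norm (p i)" using l by simp
      also have "\<dots> \<le> (2 * l) * M"
        using l M by (intro mult_mono) (auto simp: field_simps)
      finally show ?thesis .
    qed
    hence P: "\<mu> (range ?p) \<le> \<mu> (range p) + (2 * l * M) * C"
      unfolding C_def using l M by (intro convex_mnc_perturb[OF mu]) auto
    have bp: "bounded (range ?p)" using p bounded_scaling[of "range p" "1 / (1 - l)"] by (simp add: image_image)
    have ce: "compact (closure (range ?e))"
    proof -
      have "closure (range ?e) = (*\<^sub>R) (1 / l) ` closure (range e)"
        by (simp add: closure_scaleR image_image)
      thus ?thesis using compact_scaling[OF e] by simp
    qed
    have be: "bounded (range ?e)"
      using compact_imp_bounded[OF ce] bounded_subset closure_subset by blast
    have e0: "\<mu> (range ?e) = 0" using convex_mnc_eq_0_iff[OF mu _ be] ce by simp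
    have "(\<lambda>i. p i + e i) = (\<lambda>i. l *\<^sub>R ?e i + (1 - l) *\<^sub>R ?p i)"
      using l by (simp add: add.commute)
    moreover have "0 \<le> l" "l \<le> 1" using l by auto
    ultimately have "\<mu> (range (\<lambda>i. p i + e i)) \<le> l * \<mu> (range ?e) + (1 - l) * \<mu> (range ?p)"
      using convex_mnc_range_convex[OF mu be bp] by (simp only:)
    also have "\<dots> \<le> 1 * \<mu> (range ?p)"
      unfolding e0 using l convex_mnc_nonneg[OF mu _ bp] by (simp add: mult_left_le_one_le)
    finally show ?thesis using P by simp
  qed
  show ?thesis
  proof (rule le_if_le_add_mult_small)
    fix k :: real assume k: "0 < k" "k \<le> 1"
    have M1: "0 < M + 1" using M by simp
    \<comment> \<open>Chosen such that \<open>2 * l * M = k * (M / (M + 1))\<close>, which is at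
      most 1 and linear in \<open>k\<close>.\<close>
    define l where "l = k / (2 * (M + 1))"
    have "0 < l" "l \<le> 1 / 2" using k M by (auto simp: l_def field_simps)
    have "2 * l * M = k * (M / (M + 1))" using M1 by (simp add: l_def field_simps)
    also have "\<dots> \<le> 1" using k M by (intro mult_le_one) auto
    finally have "2 * l * M \<le> 1" .
    from key[OF \<open>0 < l\<close> \<open>l \<le> 1 / 2\<close> this]
    show "\<mu> (range (\<lambda>i. p i + e i)) \<le> \<mu> (range p) + k * (M / (M + 1) * C)"
      unfolding \<open>2 * l * M = _\<close> by (simp add: mult.assoc)
  qed
qed

text \<open>Jensen's inequality for equal weights, by induction: the mean of \<open>m + 2\<close>
  terms is the new term with weight \<open>1 / (m + 2)\<close> plus the old mean with the remaining
  weight. Counting with \<open>Suc m\<close> excludes the empty mean.\<close>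

lemma convex_mnc_mean:
  fixes p :: "nat \<Rightarrow> 'i \<Rightarrow> 'a::real_normed_vector"
  assumes mu: "convex_mnc \<mu>" and p: "\<And>k i. k \<le> m \<Longrightarrow> norm (p k i) \<le> M"
  shows "\<mu> (range (\<lambda>i. (1 / real (Suc m)) *\<^sub>R (\<Sum>k<Suc m. p k i))) \<le> (1 / real (Suc m)) * (\<Sum>k<Suc m. \<mu> (range (p k)))"
using p
proof (induction m)
  case 0
  show ?case by simp
next
  case (Suc m)
  let ?A = "\<lambda>i. (1 / real (Suc m)) *\<^sub>R (\<Sum>k<Suc m. p k i)"
  let ?l = "1 / real (Suc (Suc m))"
  have l: "1 - ?l = real (Suc m) / real (Suc (Suc m))" by (simp add: field_simps)
  have bp: "bounded (range (p (Suc m)))" using Suc.prems by (auto simp: bounded_iff)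
  have bA: "bounded (range ?A)"
  proof -
    have "norm (?A i) \<le> (1 / real (Suc m)) * (\<Sum>k<Suc m. M)" for i
      unfolding norm_scaleR
      by (intro mult_mono order_trans[OF norm_sum] sum_mono) (auto simp: Suc.prems)
    thus ?thesis unfolding bounded_iff by blast
  qed
  have "(\<lambda>i. ?l *\<^sub>R (\<Sum>k<Suc (Suc m). p k i)) = (\<lambda>i. ?l *\<^sub>R p (Suc m) i + (1 - ?l) *\<^sub>R ?A i)"
    unfolding l by (rule ext) (simp add: scaleR_add_right del: of_nat_Suc)
  moreover have "0 \<le> ?l" "?l \<le> 1" by auto
  ultimately have "\<mu> (range (\<lambda>i. ?l *\<^sub>R (\<Sum>k<Suc (Suc m). p k i))) \<le> ?l * \<mu> (range (p (Suc m))) + (1 - ?l) * \<mu> (range ?A)"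
    using convex_mnc_range_convex[OF mu bp bA] by (simp only:)
  also have "\<dots> \<le> ?l * \<mu> (range (p (Suc m))) + (1 - ?l) * ((1 / real (Suc m)) * (\<Sum>k<Suc m. \<mu> (range (p k))))"
    by (intro add_mono mult_left_mono Suc.IH Suc.prems) auto
  also have "\<dots> = ?l * (\<Sum>k<Suc (Suc m). \<mu> (range (p k)))"
    unfolding l by (simp add: distrib_left del: of_nat_Suc)
  finally show ?case .
qed

section \<open>Riemann sums\<close>

text \<open>Taking \<open>m * d\<close> as right end point lets the induction on \<open>m\<close>
  peel off the last cell, where \<open>g\<close> differs from its value at the left end by at most
  \<open>e\<close>.\<close>

lemma norm_integral_minus_Riemann_sum_le:
  fixes g :: "real \<Rightarrow> 'a::banach"
  assumes g: "continuous_on {0..real m * d} g" and d: "0 \<le> d"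
    and osc: "\<And>s s'. s \<in> {0..real m * d} \<Longrightarrow> s' \<in> {0..real m * d} \<Longrightarrow> \<bar>s - s'\<bar> \<le> d \<Longrightarrow> norm (g s - g s') \<le> e"
  shows "norm (integral {0..real m * d} g - d *\<^sub>R (\<Sum>k<m. g (real k * d))) \<le> e * (real m * d)"
  using g osc
proof (induction m)
  case 0
  show ?case by simp
next
  case (Suc m)
  have le: "real m * d \<le> real (Suc m) * d" "0 \<le> real m * d" using d by (auto simp: mult_right_mono)
  have c: "continuous_on {0..real m * d} g" 
    using Suc.prems(1) by (rule continuous_on_subset) (use le in auto)
  have int: "g integrable_on {0..real (Suc m) * d}" using Suc.prems(1) by (rule integrable_continuous_real)
  have int1: "g integrable_on {real m * d..real (Suc m) * d}"
    using int by (rule integrable_on_subinterval) (use le in auto)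
  have IH: "norm (integral {0..real m * d} g - d *\<^sub>R (\<Sum>k<m. g (real k * d))) \<le> e * (real m * d)"
    using c Suc.prems(2) le by (intro Suc.IH) auto
  have "((\<lambda>s. g s - g (real m * d)) has_integral (integral {real m * d..real (Suc m) * d} g - d *\<^sub>R g (real m * d))) {real m * d..real (Suc m) * d}"
    using has_integral_diff[OF integrable_integral[OF int1] has_integral_const_real[of "g (real m * d)" "real m * d" "real (Suc m) * d"]] d
    by (simp add: algebra_simps)
  moreover have "norm (g s - g (real m * d)) \<le> e" if "s \<in> {real m * d..real (Suc m) * d}" for s
    using that le d by (intro Suc.prems(2)) (auto simp: algebra_simps intro: order_trans[rotated])
  moreover have "0 \<le> e" using Suc.prems(2)[of 0 0] le d by simp
  ultimately have "norm (integral {real m * d..real (Suc m) * d} g - d *\<^sub>R g (real m * d)) \<le> e * measure lborel {real m * d..real (Suc m) * d}"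
    by (intro has_integral_bound_real[where S = "{}"]) auto
  hence st: "norm (integral {real m * d..real (Suc m) * d} g - d *\<^sub>R g (real m * d)) \<le> e * d"
    using le by (simp add: algebra_simps)
  have "integral {0..real (Suc m) * d} g - d *\<^sub>R (\<Sum>k<Suc m. g (real k * d))
     = (integral {0..real m * d} g - d *\<^sub>R (\<Sum>k<m. g (real k * d)))
       + (integral {real m * d..real (Suc m) * d} g - d *\<^sub>R g (real m * d))"
    using Henstock_Kurzweil_Integration.integral_combine[OF le(2,1) int] by (simp add: scaleR_add_right)
  also have "norm \<dots> \<le> e * (real m * d) + e * d" by (intro norm_triangle_mono IH st)
  finally show ?case by (simp add: algebra_simps)
qed

section \<open>Equicontinuous families of functions\<close>

text \<open>A single \<open>d\<close> serves all indices \<open>i\<close> because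
  \<open>convex_mnc_perturb\<close> needs a bound uniform in the index.\<close>

definition uniformly_equicontinuous_on :: "real set \<Rightarrow> ('i \<Rightarrow> real \<Rightarrow> 'a::real_normed_vector) \<Rightarrow> bool" where
  "uniformly_equicontinuous_on S g \<longleftrightarrow>
     (\<forall>e>0. \<exists>d>0. \<forall>i. \<forall>s\<in>S. \<forall>s'\<in>S. \<bar>s - s'\<bar> < d \<longrightarrow> norm (g i s - g i s') < e)"

lemma uniformly_equicontinuous_onE:
  assumes "uniformly_equicontinuous_on S g" "0 < e"
  obtains d where "0 < d" "\<And>i s s'. s \<in> S \<Longrightarrow> s' \<in> S \<Longrightarrow> \<bar>s - s'\<bar> < d \<Longrightarrow> norm (g i s - g i s') < e"
proof -
  have "\<exists>d>0. \<forall>i. \<forall>s\<in>S. \<forall>s'\<in>S. \<bar>s - s'\<bar> < d \<longrightarrow> norm (g i s - g i s') < e"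
    using assms by (simp add: uniformly_equicontinuous_on_def)
  thus thesis using that by blast
qed

lemma uniformly_equicontinuous_on_subset:
  assumes "uniformly_equicontinuous_on S g" "T \<subseteq> S"
  shows "uniformly_equicontinuous_on T g"
  unfolding uniformly_equicontinuous_on_def
proof (intro allI impI)
  fix e :: real assume "0 < e"
  with assms(1) obtain d where "0 < d"
    "\<And>i s s'. s \<in> S \<Longrightarrow> s' \<in> S \<Longrightarrow> \<bar>s - s'\<bar> < d \<Longrightarrow> norm (g i s - g i s') < e"
    by (rule uniformly_equicontinuous_onE) blast
  thus "\<exists>d>0. \<forall>i. \<forall>s\<in>T. \<forall>s'\<in>T. \<bar>s - s'\<bar> < d \<longrightarrow> norm (g i s - g i s') < e"
    using assms(2) by (intro exI[of _ d]) auto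
qed

lemma uniformly_equicontinuous_on_imp_continuous_on:
  assumes "uniformly_equicontinuous_on S g"
  shows "continuous_on S (g i)"
  unfolding continuous_on_iff
proof (intro ballI allI impI)
  fix x e :: real assume "x \<in> S" "0 < e"
  from assms this(2) show "\<exists>d>0. \<forall>x'\<in>S. dist x' x < d \<longrightarrow> dist (g i x') (g i x) < e"
    by (rule uniformly_equicontinuous_onE) (use \<open>x \<in> S\<close> in \<open>auto simp: dist_norm\<close>)
qed

text \<open>The time map \<open>\<tau>\<close> covers both uses: the identity gives
  \<open>f s (X i s)\<close>, a constant gives \<open>f t (X i s)\<close> with frozen time.\<close>

lemma uniformly_equicontinuous_on_compose:
  fixes f :: "real \<Rightarrow> 'a::real_normed_vector \<Rightarrow> 'b::real_normed_vector"
  assumes f: "uniformly_continuous_on (T \<times> D) (\<lambda>(t, x). f t x)"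
    and X: "uniformly_equicontinuous_on S X" and XD: "\<And>i s. s \<in> S \<Longrightarrow> X i s \<in> D"
    and \<tau>: "\<And>s. s \<in> S \<Longrightarrow> \<tau> s \<in> T" "\<And>s s'. \<bar>\<tau> s - \<tau> s'\<bar> \<le> \<bar>s - s'\<bar>"
  shows "uniformly_equicontinuous_on S (\<lambda>i s. f (\<tau> s) (X i s))"
  unfolding uniformly_equicontinuous_on_def
proof (intro allI impI)
  fix e :: real assume "0 < e"
  with f obtain d where d: "0 < d" and fd: "\<And>p q. p \<in> T \<times> D \<Longrightarrow> q \<in> T \<times> D \<Longrightarrow> dist q p < d
      \<Longrightarrow> dist (case q of (t, x) \<Rightarrow> f t x) (case p of (t, x) \<Rightarrow> f t x) < e"
    by (rule uniformly_continuous_onE) blast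
  from d have "0 < d / 2" by simp
  with X obtain d' where d': "0 < d'"
    "\<And>i s s'. s \<in> S \<Longrightarrow> s' \<in> S \<Longrightarrow> \<bar>s - s'\<bar> < d' \<Longrightarrow> norm (X i s - X i s') < d / 2"
    by (rule uniformly_equicontinuous_onE) blast
  have "norm (f (\<tau> s) (X i s) - f (\<tau> s') (X i s')) < e"
    if s: "s \<in> S" "s' \<in> S" "\<bar>s - s'\<bar> < min d' (d / 2)" for i s s'
  proof -
    have "dist (\<tau> s, X i s) (\<tau> s', X i s') \<le> \<bar>\<tau> s - \<tau> s'\<bar> + norm (X i s - X i s')"
      using norm_Pair_le[of "\<tau> s - \<tau> s'" "X i s - X i s'"] by (simp add: dist_norm)
    also have "\<dots> < d" using d'(2)[of s s' i] \<tau>(2)[of s s'] s by simp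
    finally have "dist (\<tau> s, X i s) (\<tau> s', X i s') < d" .
    from fd[OF _ _ this] show ?thesis using s XD \<tau>(1) by (simp add: dist_norm)
  qed
  thus "\<exists>d>0. \<forall>i. \<forall>s\<in>S. \<forall>s'\<in>S. \<bar>s - s'\<bar> < d \<longrightarrow> norm (f (\<tau> s) (X i s) - f (\<tau> s') (X i s')) < e"
    using d d'(1) by (intro exI[of _ "min d' (d / 2)"] conjI allI ballI impI) simp_all
qed

section \<open>Measures of noncompactness along equicontinuous families\<close>

text \<open>Close arguments give uniformly close families, and \<open>convex_mnc_perturb\<close>
  applies in both directions.\<close>

lemma convex_mnc_uniformly_continuous_on:
  fixes g :: "'i \<Rightarrow> real \<Rightarrow> 'a::real_normed_vector"
  assumes mu: "convex_mnc \<mu>" and g: "uniformly_equicontinuous_on S g"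
    and M: "\<And>i s. s \<in> S \<Longrightarrow> norm (g i s) \<le> M"
  shows "uniformly_continuous_on S (\<lambda>s. \<mu> (range (\<lambda>i. g i s)))"
  unfolding uniformly_continuous_on_def
proof (intro allI impI)
  \<comment> \<open>If \<open>S\<close> is empty, \<open>M\<close> may be negative; the absolute
    value keeps the ball nonempty, so that \<open>C\<close> is nonnegative.\<close>
  define C where "C = \<mu> (cball (0::'a) (\<bar>M\<bar> + 1))"
  have C: "0 \<le> C" unfolding C_def by (rule convex_mnc_nonneg[OF mu]) auto
  fix e :: real assume e: "0 < e"
  \<comment> \<open>A perturbation of size \<open>\<eta>\<close> costs \<open>\<eta> * C\<close>,
    which has to stay below \<open>e\<close>; \<open>C + 1\<close> covers the case
    \<open>C = 0\<close>.\<close>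
  define \<eta> where "\<eta> = min 1 (e / (2 * (C + 1)))"
  have \<eta>: "0 < \<eta>" "\<eta> \<le> 1" using e C by (auto simp: \<eta>_def)
  have \<eta>C: "\<eta> * C < e"
  proof -
    have "\<eta> * C \<le> e / (2 * (C + 1)) * C" by (intro mult_right_mono C) (auto simp: \<eta>_def)
    also have "\<dots> < e"
      using e C by (simp add: field_simps add_nonneg_pos)
    finally show ?thesis .
  qed
  from g \<eta>(1) obtain d where d: "0 < d"
    "\<And>i s s'. s \<in> S \<Longrightarrow> s' \<in> S \<Longrightarrow> \<bar>s - s'\<bar> < d \<Longrightarrow> norm (g i s - g i s') < \<eta>"
    by (rule uniformly_equicontinuous_onE) blast
  have "\<mu> (range (\<lambda>i. g i s')) < \<mu> (range (\<lambda>i. g i s)) + e"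
    if "s \<in> S" "s' \<in> S" "\<bar>s' - s\<bar> < d" for s s'
  proof -
    have "\<mu> (range (\<lambda>i. g i s')) \<le> \<mu> (range (\<lambda>i. g i s)) + \<eta> * C" unfolding C_def
      by (intro convex_mnc_perturb[OF mu] \<eta> order_trans[OF M[OF that(1)] abs_ge_self] less_imp_le[OF d(2)[OF that(2,1,3)]])
    thus ?thesis using \<eta>C by simp
  qed
  note * = this
  show "\<exists>d>0. \<forall>s\<in>S. \<forall>s'\<in>S. dist s' s < d \<longrightarrow>
      dist (\<mu> (range (\<lambda>i. g i s'))) (\<mu> (range (\<lambda>i. g i s))) < e"
  proof (intro exI[of _ d] conjI ballI impI d)
    fix s s' assume s: "s \<in> S" "s' \<in> S" "dist s' s < d"
    thus "dist (\<mu> (range (\<lambda>i. g i s'))) (\<mu> (range (\<lambda>i. g i s))) < e"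
      using *[of s s'] *[of s' s] by (simp add: dist_real_def abs_minus_commute abs_less_iff)
  qed
qed

text \<open>Up to \<open>e\<close>, the integral is \<open>t\<close> times a mean of values.
  \<open>scale\<close> pulls out \<open>t\<close>, Jensen's inequality bounds the mean, and the
  result is a Riemann sum of the real integrand.\<close>

lemma convex_mnc_integral_le:
  fixes g :: "'i \<Rightarrow> real \<Rightarrow> 'a::banach"
  assumes mu: "convex_mnc \<mu>" and g: "uniformly_equicontinuous_on {0..t} g"
    and M: "\<And>i s. s \<in> {0..t} \<Longrightarrow> norm (g i s) \<le> M" and t: "0 \<le> t"
    and scale: "\<And>p :: 'i \<Rightarrow> 'a. bounded (range p) \<Longrightarrow> \<mu> (range (\<lambda>i. t *\<^sub>R p i)) \<le> t * \<mu> (range p)"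
  shows "\<mu> (range (\<lambda>i. integral {0..t} (g i))) \<le> integral {0..t} (\<lambda>s. \<mu> (range (\<lambda>i. g i s)))"
proof (cases "t = 0")
  case True
  have "\<mu> {0} = 0" using convex_mnc_eq_0_iff[OF mu, of "{0}"] by simp
  thus ?thesis using True by simp
next
  case False
  hence t: "0 < t" using t by simp
  let ?h = "\<lambda>s. \<mu> (range (\<lambda>i. g i s))"
  have h: "uniformly_continuous_on {0..t} ?h"
    by (rule convex_mnc_uniformly_continuous_on[OF mu g M])
  \<comment> \<open>\<open>t * M\<close> bounds the Riemann sums of the \<open>g i\<close>, which
    form the family perturbed below.\<close>
  define C where "C = \<mu> (cball (0::'a) (t * M + 1))"
  show ?thesis
  proof (rule le_if_le_add_mult_small)
    fix e :: real assume e: "0 < e" "e \<le> 1"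
    hence "0 < e / t" using t by simp
    with g obtain d1 where d1: "0 < d1"
      "\<And>i s s'. s \<in> {0..t} \<Longrightarrow> s' \<in> {0..t} \<Longrightarrow> \<bar>s - s'\<bar> < d1 \<Longrightarrow> norm (g i s - g i s') < e / t"
      by (rule uniformly_equicontinuous_onE) blast
    from h \<open>0 < e / t\<close> obtain d2 where d2: "0 < d2"
      "\<And>s s'. s' \<in> {0..t} \<Longrightarrow> s \<in> {0..t} \<Longrightarrow> dist s s' < d2 \<Longrightarrow> dist (?h s) (?h s') < e / t"
      by (rule uniformly_continuous_onE) blast
    \<comment> \<open>The mesh is finer than both moduli, so one partition serves the family
      \<open>g\<close> and the real function \<open>?h\<close>.\<close>
    obtain m where m: "t / min d1 d2 < real (Suc m)"
      using reals_Archimedean2[of "t / min d1 d2"] by (meson less_Suc_eq less_trans of_nat_less_iff lessI)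
    define d where "d = t / real (Suc m)"
    have d: "0 < d" "d < d1" "d < d2" "real (Suc m) * d = t"
    proof -
      have "t < real (Suc m) * min d1 d2" using m d1 d2 by (simp add: divide_less_eq del: of_nat_Suc)
      hence "d < min d1 d2" unfolding d_def by (subst pos_divide_less_eq) (simp_all only: mult.commute of_nat_0_less_iff zero_less_Suc)
      thus "0 < d" "d < d1" "d < d2" "real (Suc m) * d = t" using t by (auto simp: d_def)
    qed
    have kd: "real k * d \<in> {0..t}" if "k \<le> m" for k
    proof -
      have "real k * d \<le> real (Suc m) * d" using d that by (intro mult_right_mono) auto
      thus ?thesis unfolding d(4) using d(1) by simp
    qed
    have G: "norm (integral {0..t} (g i) - d *\<^sub>R (\<Sum>k<Suc m. g i (real k * d))) \<le> e" for i
    proof -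
      have "norm (integral {0..real (Suc m) * d} (g i) - d *\<^sub>R (\<Sum>k<Suc m. g i (real k * d))) \<le> e / t * (real (Suc m) * d)"
        unfolding d(4)
        by (rule norm_integral_minus_Riemann_sum_le[of "Suc m" d, unfolded d(4)])
          (use d1 d uniformly_equicontinuous_on_imp_continuous_on[OF g] in \<open>auto intro: less_imp_le\<close>)
      thus ?thesis unfolding d(4) using t by simp
    qed
    have H: "norm (integral {0..t} ?h - d *\<^sub>R (\<Sum>k<Suc m. ?h (real k * d))) \<le> e"
    proof -
      have "norm (integral {0..real (Suc m) * d} ?h - d *\<^sub>R (\<Sum>k<Suc m. ?h (real k * d))) \<le> e / t * (real (Suc m) * d)"
        unfolding d(4)
        by (rule norm_integral_minus_Riemann_sum_le[of "Suc m" d, unfolded d(4)])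
          (use d2 d uniformly_continuous_imp_continuous[OF h] in \<open>auto intro: less_imp_le simp: dist_norm\<close>)
      thus ?thesis unfolding d(4) using t by simp
    qed
    \<comment> \<open>The mean of the values: \<open>t\<close> times it is the Riemann sum, which
      exposes the factor for \<open>scale\<close>.\<close>
    let ?A = "\<lambda>i. (1 / real (Suc m)) *\<^sub>R (\<Sum>k<Suc m. g i (real k * d))"
    have A: "norm (?A i) \<le> M" for i
    proof -
      have "norm (?A i) \<le> (1 / real (Suc m)) * (\<Sum>k<Suc m. M)"
        unfolding norm_scaleR
        by (intro mult_mono order_trans[OF norm_sum] sum_mono) (auto intro!: M kd simp del: of_nat_Suc)
      thus ?thesis by simp
    qed
    have tA: "t *\<^sub>R ?A i = d *\<^sub>R (\<Sum>k<Suc m. g i (real k * d))" for i by (simp add: d_def)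
    have "norm (t *\<^sub>R ?A i) \<le> t * M" for i
      unfolding norm_scaleR using t A by (intro mult_mono) auto
    hence "\<mu> (range (\<lambda>i. integral {0..t} (g i))) \<le> \<mu> (range (\<lambda>i. t *\<^sub>R ?A i)) + e * C"
      unfolding C_def using G e by (intro convex_mnc_perturb[OF mu]) (simp_all only: tA)
    also have "\<mu> (range (\<lambda>i. t *\<^sub>R ?A i)) \<le> t * \<mu> (range ?A)"
      by (rule scale) (use A in \<open>auto simp only: bounded_iff\<close>)
    also have "\<dots> \<le> t * ((1 / real (Suc m)) * (\<Sum>k<Suc m. ?h (real k * d)))"
      using t by (intro mult_left_mono convex_mnc_mean[OF mu]) (auto intro: M kd)
    also have "\<dots> = d *\<^sub>R (\<Sum>k<Suc m. ?h (real k * d))" by (simp add: d_def)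
    also have "\<dots> \<le> integral {0..t} ?h + e" using H by (simp only: real_norm_def abs_le_iff) linarith
    finally show "\<mu> (range (\<lambda>i. integral {0..t} (g i))) \<le> integral {0..t} ?h + e * (1 + C)"
      by (simp add: algebra_simps)
  qed
qed

text \<open>The hypothesis provides, for each fixed set, an exceptional null set. It is used only for the countably many
  sets \<open>range (\<lambda>i. X i q)\<close> with \<open>q\<close> rational; both sides of the inequality depend continuously on \<open>q\<close>.\<close>

lemma AE_convex_mnc_range_le:
  fixes f :: "real \<Rightarrow> 'a::real_normed_vector \<Rightarrow> 'a" and X :: "'i \<Rightarrow> real \<Rightarrow> 'a"
  assumes mu: "convex_mnc \<mu>" and b: "0 < b" and D: "bounded D"
    and f: "uniformly_continuous_on ({0..b} \<times> D) (\<lambda>(t, x). f t x)"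
    and M: "\<And>t x. t \<in> {0..b} \<Longrightarrow> x \<in> D \<Longrightarrow> norm (f t x) \<le> M"
    and X: "uniformly_equicontinuous_on {0..b} X" and XD: "\<And>i s. s \<in> {0..b} \<Longrightarrow> X i s \<in> D"
    and w: "\<And>t. t \<in> {0<..b} \<Longrightarrow> continuous_on {0..} (w t)"
    and ae: "\<And>B. B \<noteq> {} \<Longrightarrow> B \<subseteq> D \<Longrightarrow> AE t in lebesgue_on {0..b}. \<mu> (f t ` B) \<le> w t (\<mu> B)"
  shows "AE t in lebesgue_on {0..b}. 0 < t \<longrightarrow> \<mu> (range (\<lambda>i. f t (X i t))) \<le> w t (\<mu> (range (\<lambda>i. X i t)))"
proof -
  define Q where "Q = {0<..<b} \<inter> \<rat>"
  have clQ: "closure Q = {0..b}"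
    unfolding Q_def using b by (subst closure_open_Int_superset) (auto simp: Rats_closure_real)
  have Q: "Q \<subseteq> {0..b}" by (auto simp: Q_def)
  have "AE t in lebesgue_on {0..b}. \<forall>q\<in>Q. \<mu> (f t ` range (\<lambda>i. X i q)) \<le> w t (\<mu> (range (\<lambda>i. X i q)))"
    using Q XD by (intro AE_ball_countable' ae) (auto simp: Q_def countable_rat)
  moreover have "AE t in lebesgue_on {0..b}. t \<in> {0..b}"
    using AE_space[of "lebesgue_on {0..b}"] by simp
  ultimately show ?thesis
  proof eventually_elim
    case (elim t)
    show ?case
    proof
      assume "0 < t"
      hence t: "t \<in> {0<..b}" using elim by simp
      obtain R where R: "\<And>x. x \<in> D \<Longrightarrow> norm x \<le> R" using D by (auto simp: bounded_iff)
      \<comment> \<open>The time in \<open>f\<close> and \<open>w\<close> stays at \<open>t\<close>;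
        only the argument \<open>s\<close> of the families moves. The inequality thus passes from
        \<open>s\<close> in \<open>Q\<close> to its closure, in particular to
        \<open>s = t\<close>.\<close>
      let ?u = "\<lambda>s. \<mu> (range (\<lambda>i. X i s))" and ?h = "\<lambda>s. \<mu> (range (\<lambda>i. f t (X i s)))"
      have u: "continuous_on {0..b} ?u"
        by (rule uniformly_continuous_imp_continuous[OF convex_mnc_uniformly_continuous_on[OF mu X]]) (rule R[OF XD])
      have u0: "0 \<le> ?u s" if "s \<in> {0..b}" for s
        using XD[OF that] by (intro convex_mnc_nonneg[OF mu] bounded_subset[OF D]) auto
      have "uniformly_equicontinuous_on {0..b} (\<lambda>i s. f t (X i s))"
        by (rule uniformly_equicontinuous_on_compose[OF f X XD]) (use t in auto)
      hence h: "continuous_on {0..b} ?h"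
        by (intro uniformly_continuous_imp_continuous convex_mnc_uniformly_continuous_on[OF mu, where M = M])
          (use M XD t in auto)
      have "continuous_on {0..b} (\<lambda>s. ?h s - w t (?u s))"
        by (intro continuous_on_diff h continuous_on_compose2[OF w[OF t] u]) (use u0 in auto)
      moreover have "?h q - w t (?u q) \<le> 0" if "q \<in> Q" for q
        using elim(1) that by (simp add: image_image)
      ultimately have "?h t - w t (?u t) \<le> 0"
        using continuous_le_on_closure[of Q "\<lambda>s. ?h s - w t (?u s)" t 0] t unfolding clQ by simp
      thus "?h t \<le> w t (?u t)" by simp
    qed
  qed
qed

section \<open>Tonelli approximations\<close>

text \<open>The limits \<open>s\<close> and \<open>t\<close> may be negative, as the delayed limit
  \<open>t - d\<close> can be; integrals over the empty interval vanish.\<close>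

lemma norm_integral_diff_le:
  fixes g :: "real \<Rightarrow> 'a::banach"
  assumes g: "continuous_on {0..b} g" and M: "\<And>s. s \<in> {0..b} \<Longrightarrow> norm (g s) \<le> M"
    and M0: "0 \<le> M" and s: "s \<le> b" and t: "t \<le> b"
  shows "norm (integral {0..s} g - integral {0..t} g) \<le> M * \<bar>s - t\<bar>"
proof -
  have *: "norm (integral {0..t} g - integral {0..s} g) \<le> M * (t - s)" if st: "s \<le> t" "t \<le> b" for s t
  proof -
    consider "t < 0" | "s < 0" "0 \<le> t" | "0 \<le> s" using st by linarith
    thus ?thesis
    proof cases
      case 1
      thus ?thesis using st M0 by simp
    next
      case 2
      have "norm (integral {0..t} g) \<le> M * (t - 0)"
        by (rule integral_bound) (use 2 st M in \<open>auto intro: continuous_on_subset[OF g]\<close>)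
      also have "\<dots> \<le> M * (t - s)" using 2 M0 by (intro mult_left_mono) auto
      finally show ?thesis using 2 by simp
    next
      case 3
      have "integral {0..s} g + integral {s..t} g = integral {0..t} g"
        using 3 st by (intro Henstock_Kurzweil_Integration.integral_combine integrable_continuous_real
            continuous_on_subset[OF g]) auto
      hence "integral {0..t} g - integral {0..s} g = integral {s..t} g" by (simp add: algebra_simps)
      thus ?thesis
        using integral_bound[of s t g M] 3 st M continuous_on_subset[OF g, of "{s..t}"] by simp
    qed
  qed
  show ?thesis
  proof (cases "s \<le> t")
    case True
    thus ?thesis using *[of s t] t by (simp add: norm_minus_commute)
  next
    case False
    thus ?thesis using *[of t s] s by simp
  qed
qed

text \<open>Tonelli's delayed equation. The iterates of the integral operator, started at the constant \<open>x0\<close>, stabilize on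
  \<open>[0, k d]\<close> after \<open>k\<close> steps.\<close>

lemma delayed_integral_equation:
  fixes f :: "real \<Rightarrow> 'a::banach \<Rightarrow> 'a"
  assumes d: "0 < d" and b: "0 < b"
    and f: "continuous_on ({0..b} \<times> cball x0 r) (\<lambda>(t, x). f t x)"
    and xi: "0 \<le> \<xi>" "\<xi> * b \<le> r"
    and M: "\<And>t x. t \<in> {0..b} \<Longrightarrow> x \<in> cball x0 r \<Longrightarrow> norm (f t x) \<le> \<xi>"
  obtains x where "\<And>t. t \<in> {0..b} \<Longrightarrow> x t = x0 + integral {0..t - d} (\<lambda>s. f s (x s))"
    and "\<And>t. t \<in> {0..b} \<Longrightarrow> x t \<in> cball x0 r"
    and "\<And>s t. s \<in> {0..b} \<Longrightarrow> t \<in> {0..b} \<Longrightarrow> norm (x s - x t) \<le> \<xi> * \<bar>s - t\<bar>"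
proof -
  define \<Phi> where "\<Phi> y t = x0 + integral {0..t - d} (\<lambda>s. f s (y s))" for y t
  define Y where "Y k = (\<Phi> ^^ k) (\<lambda>_. x0)" for k
  have Y_Suc: "Y (Suc k) = \<Phi> (Y k)" for k by (simp add: Y_def)
  \<comment> \<open>Both invariants are carried together: the Lipschitz bound makes the next
    integrand continuous, and with the value \<open>x0\<close> at 0 and
    \<open>\<xi> * b \<le> r\<close> it keeps the iterate in the ball.\<close>
  have Y: "(\<forall>t\<in>{0..b}. Y k t \<in> cball x0 r) \<and> (\<forall>s\<in>{0..b}. \<forall>t\<in>{0..b}. norm (Y k s - Y k t) \<le> \<xi> * \<bar>s - t\<bar>)" for k
  proof (induction k)
    case 0
    have "0 \<le> r" using xi b by (meson mult_nonneg_nonneg less_imp_le order_trans)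
    thus ?case using xi by (simp add: Y_def)
  next
    case (Suc k)
    hence Yb: "Y k t \<in> cball x0 r" if "t \<in> {0..b}" for t using that by blast
    have "\<xi>-lipschitz_on {0..b} (Y k)" using Suc xi by (intro lipschitz_onI) (auto simp: dist_norm)
    hence "continuous_on {0..b} (Y k)" by (rule lipschitz_on_continuous_on)
    hence "continuous_on {0..b} (\<lambda>s. case (s, Y k s) of (t, x) \<Rightarrow> f t x)"
      by (intro continuous_on_compose2[OF f] continuous_intros) (use Yb in auto)
    hence c: "continuous_on {0..b} (\<lambda>s. f s (Y k s))" by simp
    have L: "norm (Y (Suc k) s - Y (Suc k) t) \<le> \<xi> * \<bar>s - t\<bar>" if "s \<in> {0..b}" "t \<in> {0..b}" for s t
      unfolding Y_Suc \<Phi>_def using norm_integral_diff_le[OF c, of \<xi> "s - d" "t - d"] M Yb xi that d by simp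
    have "Y (Suc k) t \<in> cball x0 r" if t: "t \<in> {0..b}" for t
    proof -
      have "Y (Suc k) 0 = x0" unfolding Y_Suc \<Phi>_def using d by simp
      hence "norm (x0 - Y (Suc k) t) \<le> \<xi> * t" using L[of 0 t] t b by simp
      also have "\<dots> \<le> \<xi> * b" using t xi by (intro mult_left_mono) auto
      finally show ?thesis using xi by (simp add: dist_norm)
    qed
    thus ?case using L by blast
  qed
  have eq: "Y k t = Y (Suc k) t" if "t \<le> real k * d" for k t
    using that
  proof (induction k arbitrary: t)
    case 0
    thus ?case using d by (simp add: Y_Suc \<Phi>_def) (simp add: Y_def)
  next
    case (Suc k)
    \<comment> \<open>The delay gains one step: \<open>t \<le> (k + 1) * d\<close> and
      \<open>s \<le> t - d\<close> imply \<open>s \<le> k * d\<close>.\<close>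
    have "Y k s = Y (Suc k) s" if "s \<in> {0..t - d}" for s
      by (rule Suc.IH) (use that Suc.prems in \<open>auto simp: algebra_simps\<close>)
    hence "integral {0..t - d} (\<lambda>s. f s (Y k s)) = integral {0..t - d} (\<lambda>s. f s (Y (Suc k) s))"
      by (intro integral_cong) simp
    thus ?case unfolding Y_Suc[of k] Y_Suc[of "Suc k"] by (subst (1 2) \<Phi>_def) (simp add: Y_Suc)
  qed
  obtain K where K: "b < real K * d" using d reals_Archimedean3 by blast
  show thesis
  proof (rule that[of "Y K"])
    fix t assume "t \<in> {0..b}"
    hence "Y K t = Y (Suc K) t" using K by (intro eq) auto
    thus "Y K t = x0 + integral {0..t - d} (\<lambda>s. f s (Y K s))" by (simp add: Y_Suc \<Phi>_def)
  qed (use Y in blast)+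
qed

section \<open>Cluster points and passage to the limit\<close>

text \<open>Tychonoff's theorem: the sequence lies in a compact product, so the closures of its
  tails have a common point. As \<open>S\<close> may be uncountable, no subsequence is claimed;
  \<open>n\<close> depends on \<open>T\<close> and \<open>e\<close>.\<close>

lemma pointwise_cluster_point:
  fixes X :: "nat \<Rightarrow> 'b \<Rightarrow> 'a::metric_space"
  assumes "\<And>t. t \<in> S \<Longrightarrow> compact (closure (range (\<lambda>n. X n t)))"
  obtains x where "\<And>N e T. 0 < e \<Longrightarrow> finite T \<Longrightarrow> T \<subseteq> S \<Longrightarrow> \<exists>n\<ge>N. \<forall>t\<in>T. dist (X n t) (x t) < e"
proof -
  \<comment> \<open>The constant value outside \<open>S\<close> makes the remaining factors
    singletons, so the product over the whole type is compact.\<close>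
  define Z where "Z n t = (if t \<in> S then X n t else undefined)" for n t
  define K where "K = Pi\<^sub>E UNIV (\<lambda>t. closure (range (\<lambda>n. Z n t)))"
  have "compact (closure (range (\<lambda>n. Z n t)))" for t
    using assms[of t] by (cases "t \<in> S") (simp_all add: Z_def)
  hence "compactin (product_topology (\<lambda>_::'b. euclidean :: 'a topology) UNIV) K"
    unfolding K_def by (simp add: compactin_PiE)
  hence K: "compact K" by (simp add: euclidean_product_topology)
  have ZK: "Z n \<in> K" for n unfolding K_def using closure_subset by (fastforce simp: PiE_def)
  have "K \<inter> (\<Inter>N\<in>(UNIV :: nat set). closure (Z ` {N..})) \<noteq> {}"
  proof (rule compact_imp_fip_image[OF K])
    fix I :: "nat set" assume I: "finite I"
    \<comment> \<open>Inserting 0 covers the case of empty \<open>I\<close>.\<close>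
    have "Z (Max (insert 0 I)) \<in> closure (Z ` {N..})" if "N \<in> I" for N
      using I that by (intro subsetD[OF closure_subset] imageI) simp
    thus "K \<inter> (\<Inter>N\<in>I. closure (Z ` {N..})) \<noteq> {}" using ZK by blast
  qed simp
  then obtain x where x: "\<And>N. x \<in> closure (Z ` {N..})" by auto
  show thesis
  proof (rule that[of x])
    fix N e T assume eT: "0 < (e::real)" "finite T" "T \<subseteq> S"
    define U where "U = (\<Inter>t\<in>T. {y :: 'b \<Rightarrow> 'a. dist (y t) (x t) < e})"
    have "open U" unfolding U_def
      by (intro open_INT eT ballI open_Collect_less continuous_intros continuous_on_product_coordinates)
    moreover have "x \<in> U" using eT by (simp add: U_def)
    ultimately have "U \<inter> Z ` {N..} \<noteq> {}" using x[of N] by (auto simp: closure_iff_nhds_not_empty)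
    then obtain n where "N \<le> n" "Z n \<in> U" by auto
    thus "\<exists>n\<ge>N. \<forall>t\<in>T. dist (X n t) (x t) < e"
      using eT by (intro exI[of _ n]) (auto simp: U_def Z_def dest!: bspec split: if_splits)
  qed
qed

text \<open>The common Lipschitz bound passes to a pointwise cluster point and turns closeness on a
  finite net into uniform closeness. For each accuracy a single late index \<open>n\<close> then
  suffices to pass to the limit in the integral equation.\<close>

lemma Cauchy_solution_if_relatively_compact:
  fixes f :: "real \<Rightarrow> 'a::banach \<Rightarrow> 'a" and X :: "nat \<Rightarrow> real \<Rightarrow> 'a"
  assumes b: "0 < b"
    and f: "uniformly_continuous_on ({0..b} \<times> cball x0 r) (\<lambda>(t, x). f t x)"
    and xi: "0 \<le> \<xi>" "\<xi> * b \<le> r"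
    and XD: "\<And>n t. t \<in> {0..b} \<Longrightarrow> X n t \<in> cball x0 r"
    and XL: "\<And>n s t. s \<in> {0..b} \<Longrightarrow> t \<in> {0..b} \<Longrightarrow> norm (X n s - X n t) \<le> \<xi> * \<bar>s - t\<bar>"
    and X0: "\<And>n. X n 0 = x0"
    and err: "\<And>n t. t \<in> {0..b} \<Longrightarrow>
      norm (X n t - (x0 + integral {0..t} (\<lambda>s. f s (X n s)))) \<le> \<epsilon> n" and \<epsilon>: "\<epsilon> \<longlonglongrightarrow> 0"
    and comp: "\<And>t. t \<in> {0..b} \<Longrightarrow> compact (closure (range (\<lambda>n. X n t)))"
  shows "\<exists>x. cauchy_solution f (cball x0 r) x0 b x"
proof -
  obtain x where x: "\<And>N e T. 0 < e \<Longrightarrow> finite T \<Longrightarrow> T \<subseteq> {0..b} \<Longrightarrow> \<exists>n\<ge>N. \<forall>t\<in>T. dist (X n t) (x t) < e"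
    using pointwise_cluster_point[of "{0..b}" X] comp by blast
  have xL: "norm (x s - x t) \<le> \<xi> * \<bar>s - t\<bar>" if st: "s \<in> {0..b}" "t \<in> {0..b}" for s t
  proof (rule le_if_le_add_mult_small)
    fix e :: real assume "0 < e"
    then obtain n where n: "dist (X n s) (x s) < e" "dist (X n t) (x t) < e"
      using x[of e "{s, t}" 0] st by auto
    have "norm (x s - x t) \<le> dist (X n s) (x s) + norm (X n s - X n t) + dist (X n t) (x t)"
      unfolding dist_norm by norm
    thus "norm (x s - x t) \<le> \<xi> * \<bar>s - t\<bar> + e * 2" using n XL[OF st, of n] by simp
  qed
  have x0: "x 0 = x0"
  proof (rule ccontr)
    assume "x 0 \<noteq> x0"
    thus False using x[of "dist x0 (x 0)" "{0}" 0] b X0 by auto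
  qed
  have xD: "x t \<in> cball x0 r" if t: "t \<in> {0..b}" for t
  proof -
    have "norm (x0 - x t) \<le> \<xi> * t" using xL[of 0 t] t b x0 by simp
    also have "\<dots> \<le> \<xi> * b" using t xi by (intro mult_left_mono) auto
    finally show ?thesis using xi by (simp add: dist_norm)
  qed
  have unif: "\<exists>n\<ge>N. \<forall>t\<in>{0..b}. norm (X n t - x t) \<le> e" if e: "0 < e" for N e
  proof -
    \<comment> \<open>The two moves to a net point and the closeness there get \<open>e / 3\<close>
      each; \<open>\<xi> + 1\<close> covers \<open>\<xi> = 0\<close>.\<close>
    define d where "d = e / (3 * (\<xi> + 1))"
    have d: "0 < d" "\<xi> * d \<le> e / 3" using e xi by (auto simp: d_def field_simps)
    have "seq_compact {0..b}" by (simp add: compact_imp_seq_compact)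
    with d(1) have "\<exists>T. finite T \<and> T \<subseteq> {0..b} \<and> {0..b} \<subseteq> (\<Union>t\<in>T. ball t d)"
      by (simp add: seq_compact_imp_totally_bounded)
    then obtain T where T: "finite T" "T \<subseteq> {0..b}" "{0..b} \<subseteq> (\<Union>t\<in>T. ball t d)" by blast
    obtain n where n: "n \<ge> N" "\<And>t. t \<in> T \<Longrightarrow> dist (X n t) (x t) < e / 3"
      using x[of "e / 3" T N] e T by auto
    have "norm (X n t - x t) \<le> e" if t: "t \<in> {0..b}" for t
    proof -
      from T t obtain t' where t': "t' \<in> T" "\<bar>t - t'\<bar> < d" by (auto simp: dist_real_def abs_minus_commute)
      have "\<xi> * \<bar>t - t'\<bar> \<le> \<xi> * d" using t' xi by (intro mult_left_mono) auto
      hence *: "\<xi> * \<bar>t - t'\<bar> \<le> e / 3" using d by simp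
      have "norm (X n t - x t) \<le> norm (X n t - X n t') + dist (X n t') (x t') + norm (x t - x t')"
        unfolding dist_norm by norm
      thus ?thesis using n(2)[OF t'(1)] XL[of t t' n] xL[of t t'] t t' T * by auto
    qed
    thus ?thesis using n by blast
  qed
  have f_cont: "continuous_on ({0..b} \<times> cball x0 r) (\<lambda>(t, x). f t x)"
    using f by (rule uniformly_continuous_imp_continuous)
  have compose: "continuous_on {0..b} (\<lambda>s. f s (y s))"
    if "\<And>t. t \<in> {0..b} \<Longrightarrow> y t \<in> cball x0 r"
       "\<And>s t. s \<in> {0..b} \<Longrightarrow> t \<in> {0..b} \<Longrightarrow> norm (y s - y t) \<le> \<xi> * \<bar>s - t\<bar>" for y
  proof -
    have "\<xi>-lipschitz_on {0..b} y" using that(2) xi by (intro lipschitz_onI) (auto simp: dist_norm)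
    hence "continuous_on {0..b} y" by (rule lipschitz_on_continuous_on)
    hence "continuous_on {0..b} (\<lambda>s. case (s, y s) of (t, x) \<Rightarrow> f t x)"
      by (intro continuous_on_compose2[OF f_cont] continuous_intros) (use that(1) in auto)
    thus ?thesis by simp
  qed
  have fx: "continuous_on {0..b} (\<lambda>s. f s (x s))" by (rule compose[OF xD xL])
  have fX: "continuous_on {0..b} (\<lambda>s. f s (X n s))" for n by (rule compose[OF XD XL])
  have eq: "x t = x0 + integral {0..t} (\<lambda>s. f s (x s))" if t: "t \<in> {0..b}" for t
  proof -
    have "norm (x t - (x0 + integral {0..t} (\<lambda>s. f s (x s)))) \<le> 0"
    proof (rule le_if_le_add_mult_small)
      fix e :: real assume e: "0 < e"
      from f e obtain d where d: "0 < d" and fd: "\<And>p q. p \<in> {0..b} \<times> cball x0 r \<Longrightarrow> q \<in> {0..b} \<times> cball x0 r \<Longrightarrow>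
          dist q p < d \<Longrightarrow> dist (case q of (t, x) \<Rightarrow> f t x) (case p of (t, x) \<Rightarrow> f t x) < e"
        by (rule uniformly_continuous_onE) blast
      from \<epsilon> e obtain N where N: "\<And>n. n \<ge> N \<Longrightarrow> \<epsilon> n < e"
        using order_tendstoD(2)[of \<epsilon> 0 sequentially e] by (auto simp: eventually_sequentially)
      \<comment> \<open>The bound \<open>e\<close> is for \<open>X n t - x t\<close> itself;
        \<open>d / 2\<close> makes \<open>f s (X n s)\<close> and \<open>f s (x s)\<close> differ by
        less than \<open>e\<close>.\<close>
      obtain n where n: "n \<ge> N" "\<And>t. t \<in> {0..b} \<Longrightarrow> norm (X n t - x t) \<le> min e (d / 2)"
        using unif[of "min e (d / 2)" N] d e by auto
      have sub: "{0..t} \<subseteq> {0..b}" using t by auto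
      have i: "(\<lambda>s. f s (X n s)) integrable_on {0..t}" "(\<lambda>s. f s (x s)) integrable_on {0..t}"
        by (intro integrable_continuous_real continuous_on_subset[OF _ sub] fx fX)+
      have "norm (f s (X n s) - f s (x s)) \<le> e" if s: "s \<in> {0..t}" for s
      proof -
        have "dist (s, X n s) (s, x s) < d"
          using n(2)[of s] s t d by (simp add: dist_Pair_Pair dist_norm)
        thus ?thesis using fd[of "(s, x s)" "(s, X n s)"] XD xD s sub by (auto simp: dist_norm)
      qed
      hence "norm (integral {0..t} (\<lambda>s. f s (X n s) - f s (x s))) \<le> e * (t - 0)"
        using t by (intro integral_bound continuous_intros continuous_on_subset[OF _ sub] fx fX) auto
      also have "\<dots> \<le> e * b" using t e by (intro mult_left_mono) auto
      finally have I: "norm (integral {0..t} (\<lambda>s. f s (X n s)) - integral {0..t} (\<lambda>s. f s (x s))) \<le> e * b"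
        using i by (simp add: Henstock_Kurzweil_Integration.integral_diff)
      have "norm (x t - (x0 + integral {0..t} (\<lambda>s. f s (x s)))) \<le> norm (X n t - x t)
          + norm (X n t - (x0 + integral {0..t} (\<lambda>s. f s (X n s))))
          + norm (integral {0..t} (\<lambda>s. f s (X n s)) - integral {0..t} (\<lambda>s. f s (x s)))"
        by norm
      also have "\<dots> \<le> e + e + e * b"
        using n(2)[OF t] err[OF t, of n] N[OF n(1)] I by (intro add_mono) auto
      finally show "norm (x t - (x0 + integral {0..t} (\<lambda>s. f s (x s)))) \<le> 0 + e * (2 + b)"
        by (simp add: algebra_simps)
    qed
    thus ?thesis by simp
  qed
  have "(x has_vector_derivative f t (x t)) (at t within {0..b})" if t: "t \<in> {0<..b}" for t
  proof (rule has_vector_derivative_transform[where f = "\<lambda>u. x0 + integral {0..u} (\<lambda>s. f s (x s))"])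
    show "((\<lambda>u. x0 + integral {0..u} (\<lambda>s. f s (x s))) has_vector_derivative f t (x t)) (at t within {0..b})"
      using has_vector_derivative_add[OF has_vector_derivative_const integral_has_vector_derivative[OF fx, of t]] t
      by simp
  qed (use t eq in auto)
  moreover have "continuous_on {0..b} x"
    by (rule lipschitz_on_continuous_on[of \<xi>], rule lipschitz_onI) (use xL xi in \<open>auto simp: dist_norm\<close>)
  ultimately show ?thesis unfolding cauchy_solution_def using xD x0 by blast
qed

section \<open>Kamke's uniqueness condition\<close>

text \<open>\<open>h\<close> mediates between \<open>u\<close> and \<open>w\<close>: it is
  continuous at 0, which \<open>s \<mapsto> w s (u s)\<close> need not be, so its integral yields
  the limit of \<open>u t / t\<close>; \<open>w\<close> enters only through a comparison of
  integrals in \<open>[0, \<infinity>]\<close>.\<close>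

lemma kamke_function_eq_0:
  assumes w: "kamke_function a w" and b: "0 < b" "b \<le> a"
    and u0: "\<And>t. t \<in> {0..b} \<Longrightarrow> 0 \<le> u t" and u: "continuous_on {0..b} u"
    and h: "continuous_on {0..b} h" "h 0 = 0" "\<And>t. t \<in> {0..b} \<Longrightarrow> 0 \<le> h t"
    and uh: "\<And>t. t \<in> {0..b} \<Longrightarrow> u t \<le> integral {0..t} h"
    and hw: "AE t in lebesgue_on {0..b}. 0 < t \<longrightarrow> h t \<le> w t (u t)"
    and t: "t \<in> {0..b}"
  shows "u t = 0"
proof (cases "t = 0")
  case True
  thus ?thesis using uh[of 0] u0[of 0] b by simp
next
  case False
  have hint: "h integrable_on {0..t}" if "t \<in> {0..b}" for t
    using that by (intro integrable_continuous_real continuous_on_subset[OF h(1)]) auto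
  \<comment> \<open>Kamke's condition concerns all of \<open>(0, a]\<close>, so \<open>u\<close> is continued as a constant beyond \<open>b\<close>.\<close>
  let ?v = "\<lambda>t. u (min t b)"
  have hw': "AE s in lebesgue. s \<in> {0..b} \<longrightarrow> 0 < s \<longrightarrow> h s \<le> w s (u s)"
    using hw by (subst (asm) AE_restrict_space_iff) auto
  have base: "ennreal (u t) \<le> (\<integral>\<^sup>+s\<in>{0<..t}. ennreal (w s (?v s)) \<partial>lebesgue)" if t: "t \<in> {0..b}" for t
  proof -
    have "ennreal (u t) \<le> ennreal (integral {0..t} h)" using uh[OF t] by (rule ennreal_leI)
    also have "\<dots> = (\<integral>\<^sup>+s\<in>{0..t}. ennreal (h s) \<partial>lborel)"
      using nn_integral_has_integral_lebesgue'[OF _ integrable_integral[OF hint[OF t]]] h(3) t by auto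
    also have "\<dots> = (\<integral>\<^sup>+s\<in>{0..t}. ennreal (h s) \<partial>lebesgue)" by (simp add: nn_integral_completion)
    \<comment> \<open>The right side omits the point 0, where the left integrand vanishes because
      \<open>h 0 = 0\<close>.\<close>
    also have "\<dots> \<le> (\<integral>\<^sup>+s\<in>{0<..t}. ennreal (w s (?v s)) \<partial>lebesgue)"
    proof (rule nn_integral_mono_AE)
      show "AE s in lebesgue. ennreal (h s) * indicator {0..t} s \<le> ennreal (w s (?v s)) * indicator {0<..t} s"
        using hw' by eventually_elim (use t h(2) in \<open>auto simp: indicator_def intro: ennreal_leI\<close>)
    qed
    finally show ?thesis .
  qed
  have lim: "((\<lambda>t. ?v t / t) \<longlongrightarrow> 0) (at_right 0)"
    unfolding tendsto_iff
  proof (intro allI impI)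
    fix e :: real assume e: "0 < e"
    have "\<exists>d>0. \<forall>s\<in>{0..b}. dist s 0 < d \<longrightarrow> dist (h s) (h 0) < e / 2"
      by (rule h(1)[unfolded continuous_on_iff, rule_format]) (use e b in auto)
    then obtain d where d: "0 < d" "\<And>s. s \<in> {0..b} \<Longrightarrow> \<bar>s\<bar> < d \<Longrightarrow> \<bar>h s\<bar> < e / 2"
      using h(2) by (auto simp: dist_real_def)
    have "dist (?v s / s) 0 < e" if s: "0 < s" "s < min b d" for s
    proof -
      have "u s \<le> integral {0..s} h" using s by (intro uh) auto
      also have "\<dots> \<le> integral {0..s} (\<lambda>_. e / 2)"
      proof (intro integral_le hint)
        fix s' assume "s' \<in> {0..s}"
        thus "h s' \<le> e / 2" using d(2)[of s'] s by simp
      qed (use s in auto)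
      also have "\<dots> = e / 2 * s" using s by simp
      finally have "u s / s \<le> e / 2" using s by (simp add: divide_simps mult.commute)
      hence "u s / s < e" using e by linarith
      moreover have "0 \<le> u s / s" "min s b = s" using s u0[of s] by auto
      ultimately show ?thesis by (simp only: dist_real_def diff_zero abs_of_nonneg)
    qed
    thus "\<forall>\<^sub>F s in at_right 0. dist (?v s / s) 0 < e"
      unfolding eventually_at_right_field using b d by (intro exI[of _ "min b d"]) auto
  qed
  have lim0: "(?v \<longlongrightarrow> 0) (at_right 0)"
  proof -
    have "((\<lambda>t. ?v t / t * t) \<longlongrightarrow> 0 * 0) (at_right 0)" by (intro tendsto_mult lim tendsto_ident_at)
    moreover have "\<forall>\<^sub>F t in at_right 0. ?v t / t * t = ?v t"
      unfolding eventually_at_right_field by (rule exI[of _ 1]) auto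
    ultimately show ?thesis by (simp cong: filterlim_cong add: tendsto_cong)
  qed
  have "ennreal (?v t) \<le> (\<integral>\<^sup>+s\<in>{0<..t}. ennreal (w s (?v s)) \<partial>lebesgue)" if "t \<in> {0<..a}" for t
  proof -
    \<comment> \<open>Beyond \<open>b\<close> the left side is constant, while the integral of a
      nonnegative function can only grow with \<open>t\<close>.\<close>
    have "ennreal (?v t) \<le> (\<integral>\<^sup>+s\<in>{0<..min t b}. ennreal (w s (?v s)) \<partial>lebesgue)"
      using that b by (intro base) auto
    also have "\<dots> \<le> (\<integral>\<^sup>+s\<in>{0<..t}. ennreal (w s (?v s)) \<partial>lebesgue)"
      by (intro nn_integral_mono) (auto simp: indicator_def)
    finally show ?thesis .
  qed
  moreover have "continuous_on {0<..a} ?v"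
    by (intro continuous_on_compose2[OF u] continuous_intros) (use b in auto)
  ultimately have "kamke_solution a w ?v"
    unfolding kamke_solution_def using u0 b lim lim0 by auto
  moreover have "\<forall>u. kamke_solution a w u \<longrightarrow> (\<forall>t\<in>{0<..a}. u t = 0)"
    using w by (simp add: kamke_function_def)
  ultimately have "\<forall>t\<in>{0<..a}. ?v t = 0" by blast
  moreover have "t \<in> {0<..a}" "min t b = t" using t b False by auto
  ultimately show ?thesis by fastforce
qed

lemma compact_closure_range_if_convergent:
  fixes e :: "nat \<Rightarrow> 'a::metric_space"
  assumes "e \<longlonglongrightarrow> l"
  shows "compact (closure (range e))"
proof -
  have "compactin euclidean (insert l (range e))"
    by (rule compactin_sequence_with_limit) (use assms in auto)
  hence K: "compact (insert l (range e))" by simp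
  have "closure (range e) \<subseteq> insert l (range e)"
    by (rule closure_minimal) (use compact_imp_closed[OF K] in auto)
  hence "closure (range e) = insert l (range e) \<inter> closure (range e)" by blast
  thus ?thesis using compact_Int_closed[OF K closed_closure] by metis
qed

section \<open>Existence of solutions\<close>

text \<open>The end point \<open>b\<close> and the hypothesis \<open>scale\<close> vary with the
  case: \<open>b = min 1 a\<close> serves a convex measure, \<open>b = a\<close> a sublinear
  one.\<close>

lemma Cauchy_solution_if_convex_mnc:
  fixes x0 :: "'a::banach" and f :: "real \<Rightarrow> 'a \<Rightarrow> 'a"
  assumes mu: "convex_mnc \<mu>" and w: "kamke_function a w" and b: "0 < b" "b \<le> a"
    and scale: "\<And>t (p :: nat \<Rightarrow> 'a). 0 \<le> t \<Longrightarrow> t \<le> b \<Longrightarrow> bounded (range p) \<Longrightarrow>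
      \<mu> (range (\<lambda>i. t *\<^sub>R p i)) \<le> t * \<mu> (range p)"
    and f: "uniformly_continuous_on ({0..b} \<times> cball x0 r) (\<lambda>(t, x). f t x)"
    and xi: "0 \<le> \<xi>" "\<xi> * b \<le> r"
    and M: "\<And>t x. t \<in> {0..b} \<Longrightarrow> x \<in> cball x0 r \<Longrightarrow> norm (f t x) \<le> \<xi>"
    and ae: "\<And>B. B \<noteq> {} \<Longrightarrow> B \<subseteq> cball x0 r \<Longrightarrow> AE t in lebesgue_on {0..b}. \<mu> (f t ` B) \<le> w t (\<mu> B)"
  shows "\<exists>x. cauchy_solution f (cball x0 r) x0 b x"
proof -
  define d where "d n = b / real (Suc n)" for n
  have d: "0 < d n" for n using b by (simp add: d_def)
  have "\<exists>x. (\<forall>t\<in>{0..b}. x t = x0 + integral {0..t - d n} (\<lambda>s. f s (x s))) \<and> (\<forall>t\<in>{0..b}. x t \<in> cball x0 r)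
      \<and> (\<forall>s\<in>{0..b}. \<forall>t\<in>{0..b}. norm (x s - x t) \<le> \<xi> * \<bar>s - t\<bar>)" for n
    by (rule delayed_integral_equation[OF d b(1) uniformly_continuous_imp_continuous[OF f] xi M]) blast+
  then obtain X where X: "\<forall>t\<in>{0..b}. X n t = x0 + integral {0..t - d n} (\<lambda>s. f s (X n s))"
      "\<forall>t\<in>{0..b}. X n t \<in> cball x0 r"
      "\<forall>s\<in>{0..b}. \<forall>t\<in>{0..b}. norm (X n s - X n t) \<le> \<xi> * \<bar>s - t\<bar>" for n
    by metis
  have XD: "X n t \<in> cball x0 r" if "t \<in> {0..b}" for n t using X(2) that by blast
  have XL: "norm (X n s - X n t) \<le> \<xi> * \<bar>s - t\<bar>" if "s \<in> {0..b}" "t \<in> {0..b}" for n s t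
    using X(3) that by blast
  have X0: "X n 0 = x0" for n using X(1)[of n] b d[of n] by simp
  have Xc: "uniformly_equicontinuous_on {0..b} X"
    unfolding uniformly_equicontinuous_on_def
  proof (intro allI impI)
    fix e :: real assume e: "0 < e"
    have "norm (X n s - X n s') < e" if "s \<in> {0..b}" "s' \<in> {0..b}" "\<bar>s - s'\<bar> < e / (\<xi> + 1)" for n s s'
    proof -
      have "norm (X n s - X n s') \<le> (\<xi> + 1) * \<bar>s - s'\<bar>"
        using XL[OF that(1,2), of n] by (simp add: algebra_simps)
      also have "\<dots> < e" using that(3) xi by (simp add: field_simps)
      finally show ?thesis .
    qed
    thus "\<exists>d>0. \<forall>n. \<forall>s\<in>{0..b}. \<forall>s'\<in>{0..b}. \<bar>s - s'\<bar> < d \<longrightarrow> norm (X n s - X n s') < e"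
      using e xi by (intro exI[of _ "e / (\<xi> + 1)"]) auto
  qed
  define G where "G n s = f s (X n s)" for n s
  have Gc: "uniformly_equicontinuous_on {0..b} G"
    unfolding G_def by (rule uniformly_equicontinuous_on_compose[OF f Xc XD]) auto
  have GM: "norm (G n s) \<le> \<xi>" if "s \<in> {0..b}" for n s
    unfolding G_def using that M XD by blast
  \<comment> \<open>The part of \<open>X n t\<close> that the undelayed integral leaves over:
    \<open>x0\<close> plus the delay error. It converges to \<open>x0\<close> in \<open>n\<close>,
    hence forms a relatively compact family for each \<open>t\<close>.\<close>
  define e where "e t n = X n t - integral {0..t} (G n)" for t n
  have err: "norm (e t n - x0) \<le> \<xi> * d n" if t: "t \<in> {0..b}" for t n
  proof -
    have "e t n - x0 = integral {0..t - d n} (G n) - integral {0..t} (G n)"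
      using X(1)[of n] t by (simp add: e_def G_def[abs_def])
    also have "norm \<dots> \<le> \<xi> * \<bar>(t - d n) - t\<bar>"
      by (rule norm_integral_diff_le[where b = b])
        (use GM xi t d[of n] uniformly_equicontinuous_on_imp_continuous_on[OF Gc] in auto)
    finally show ?thesis using d[of n] by simp
  qed
  have \<epsilon>: "(\<lambda>n. \<xi> * d n) \<longlonglongrightarrow> 0"
    using LIMSEQ_Suc[OF lim_const_over_n[of b]] unfolding d_def by (rule tendsto_mult_right_zero)
  have XR: "norm (X n t) \<le> norm x0 + r" if "t \<in> {0..b}" for n t
    using XD[OF that, of n] norm_triangle_ineq2[of "X n t" x0] by (simp add: dist_norm norm_minus_commute)
  let ?u = "\<lambda>t. \<mu> (range (\<lambda>n. X n t))" and ?h = "\<lambda>t. \<mu> (range (\<lambda>n. G n t))"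
  have Xb: "bounded (range (\<lambda>n. X n t))" if "t \<in> {0..b}" for t using XR[OF that] by (auto simp: bounded_iff)
  have Gb: "bounded (range (\<lambda>n. G n t))" if "t \<in> {0..b}" for t using GM[OF that] by (auto simp: bounded_iff)
  have uh: "?u t \<le> integral {0..t} ?h" if t: "t \<in> {0..b}" for t
  proof -
    have sub: "{0..t} \<subseteq> {0..b}" using t by auto
    have "norm (integral {0..t} (G n)) \<le> \<xi> * (t - 0)" for n
      using t GM by (intro integral_bound continuous_on_subset[OF _ sub]
          uniformly_equicontinuous_on_imp_continuous_on[OF Gc]) auto
    hence bI: "bounded (range (\<lambda>n. integral {0..t} (G n)))" unfolding bounded_iff by blast
    have "(\<lambda>n. e t n - x0) \<longlonglongrightarrow> 0"
      by (rule Lim_null_comparison[OF _ \<epsilon>]) (use err[OF t] in auto)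
    hence "e t \<longlonglongrightarrow> x0" by (simp add: LIM_zero_iff)
    hence "compact (closure (range (e t)))" by (rule compact_closure_range_if_convergent)
    from convex_mnc_add_compact[OF mu bI this]
    have "?u t \<le> \<mu> (range (\<lambda>n. integral {0..t} (G n)))" by (simp add: e_def)
    also have "\<dots> \<le> integral {0..t} ?h"
      by (rule convex_mnc_integral_le[OF mu uniformly_equicontinuous_on_subset[OF Gc sub], where M = \<xi>])
        (use GM t sub scale in auto)
    finally show ?thesis .
  qed
  have u0: "?u t = 0" if t: "t \<in> {0..b}" for t
  proof (rule kamke_function_eq_0[OF w b, where u = ?u and h = ?h])
    show "continuous_on {0..b} ?u"
      by (rule uniformly_continuous_imp_continuous[OF convex_mnc_uniformly_continuous_on[OF mu Xc]]) (rule XR)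
    show "continuous_on {0..b} ?h"
      by (rule uniformly_continuous_imp_continuous[OF convex_mnc_uniformly_continuous_on[OF mu Gc]]) (rule GM)
    \<comment> \<open>All approximations start at \<open>x0\<close>, so only one value occurs at
      time 0, and a singleton has measure zero.\<close>
    have "range (\<lambda>n. G n 0) = {f 0 x0}" by (auto simp: G_def X0)
    thus "?h 0 = 0" using convex_mnc_eq_0_iff[OF mu, of "{f 0 x0}"] by simp
    show "AE t in lebesgue_on {0..b}. 0 < t \<longrightarrow> ?h t \<le> w t (?u t)"
      unfolding G_def
    proof (rule AE_convex_mnc_range_le[OF mu b(1) bounded_cball f M Xc XD _ ae])
      show "continuous_on {0..} (w t)" if "t \<in> {0<..b}" for t
        using w b that by (auto simp: kamke_function_def)
    qed
  qed (use t uh Xb Gb convex_mnc_nonneg[OF mu] in auto)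
  show ?thesis
  proof (rule Cauchy_solution_if_relatively_compact[OF b(1) f xi XD XL X0 _ \<epsilon>])
    fix n t assume t: "t \<in> {0..b}"
    show "norm (X n t - (x0 + integral {0..t} (\<lambda>s. f s (X n s)))) \<le> \<xi> * d n"
      using err[OF t, of n] by (simp add: e_def G_def[abs_def] algebra_simps)
    show "compact (closure (range (\<lambda>n. X n t)))"
      using u0[OF t] convex_mnc_eq_0_iff[OF mu _ Xb[OF t]] by simp
  qed
qed

section \<open>Sublinear measures, scaling and the two cases of the theorem\<close>

lemma convex_mnc_if_sublinear_mnc:
  fixes \<mu> :: "'a::real_normed_vector set \<Rightarrow> real"
  assumes "sublinear_mnc \<mu>"
  shows "convex_mnc \<mu>"
proof -
  have add: "\<mu> {x + y | x y. x \<in> A \<and> y \<in> B} \<le> \<mu> A + \<mu> B" if "A \<in> bdd_sets" "B \<in> bdd_sets" for A B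
    using assms that unfolding sublinear_mnc_def by blast
  have scale: "\<mu> ((\<lambda>x. k *\<^sub>R x) ` B) = k * \<mu> B" if "B \<in> bdd_sets" "0 \<le> k" for B k
    using assms that unfolding sublinear_mnc_def by blast
  have "\<mu> {l *\<^sub>R x + (1 - l) *\<^sub>R y | x y. x \<in> A \<and> y \<in> B} \<le> l * \<mu> A + (1 - l) * \<mu> B"
    if AB: "A \<in> bdd_sets" "B \<in> bdd_sets" and l: "0 \<le> l" "l \<le> 1" for A B l
  proof -
    have S: "(\<lambda>x. l *\<^sub>R x) ` A \<in> bdd_sets" "(\<lambda>x. (1 - l) *\<^sub>R x) ` B \<in> bdd_sets"
      using AB by (auto simp: bdd_sets_def intro: bounded_scaling)
    have "{l *\<^sub>R x + (1 - l) *\<^sub>R y | x y. x \<in> A \<and> y \<in> B}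
        = {x + y | x y. x \<in> (\<lambda>x. l *\<^sub>R x) ` A \<and> y \<in> (\<lambda>x. (1 - l) *\<^sub>R x) ` B}"
      by blast
    thus ?thesis using add[OF S] scale[OF AB(1) l(1)] scale[OF AB(2), of "1 - l"] l by simp
  qed
  thus ?thesis using assms unfolding convex_mnc_def sublinear_mnc_def by blast
qed

text \<open>\<open>t p = t p + (1 - t) 0\<close>; this is where \<open>t \<le> 1\<close>, hence the interval \<open>[0, min 1 a]\<close>, comes from.\<close>

lemma convex_mnc_scaleR_le:
  fixes p :: "'i \<Rightarrow> 'a::real_normed_vector"
  assumes mu: "convex_mnc \<mu>" and t: "0 \<le> t" "t \<le> 1" and p: "bounded (range p)"
  shows "\<mu> (range (\<lambda>i. t *\<^sub>R p i)) \<le> t * \<mu> (range p)"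
proof -
  have "range (\<lambda>i. 0 :: 'a) = {0}" by auto
  moreover have "\<mu> {0} = 0" using convex_mnc_eq_0_iff[OF mu, of "{0}"] by simp
  ultimately show ?thesis using convex_mnc_range_convex[OF mu p _ t, of "\<lambda>_. 0"] by simp
qed

lemma uniformly_continuous_on_mono:
  fixes f :: "'a::metric_space \<Rightarrow> 'b::metric_space"
  assumes "uniformly_continuous_on S f" "T \<subseteq> S"
  shows "uniformly_continuous_on T f"
  unfolding uniformly_continuous_on_def
proof (intro allI impI)
  fix e :: real assume "0 < e"
  with assms(1) obtain d where "0 < d"
    "\<And>x x'. x \<in> S \<Longrightarrow> x' \<in> S \<Longrightarrow> dist x' x < d \<Longrightarrow> dist (f x') (f x) < e"
    by (rule uniformly_continuous_onE) blast
  thus "\<exists>d>0. \<forall>x\<in>T. \<forall>x'\<in>T. dist x' x < d \<longrightarrow> dist (f x') (f x) < e"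
    using assms(2) by (intro exI[of _ d]) auto
qed

text \<open>By time \<open>b\<close> a solution moves at most \<open>\<xi> * b\<close>, which is at
  most \<open>r\<close> for \<open>b \<le> 1\<close>. On all of \<open>[0, a]\<close> the condition
  \<open>\<xi> * a \<le> r\<close> takes over: for \<open>a > 1\<close> a constant \<open>f\<close>
  of norm \<open>\<xi> = r\<close> meets the other assumptions, yet its solution leaves the ball
  after time 1.\<close>

theorem theorem7p3:
  fixes x0 :: "'a::banach" and f :: "real \<Rightarrow> 'a \<Rightarrow> 'a" and \<mu> :: "'a set \<Rightarrow> real"
    and w :: "real \<Rightarrow> real \<Rightarrow> real" and a r \<xi> :: real
  assumes infinite_dim: "\<not> (\<exists>S::'a set. finite S \<and> span S = UNIV)"
    and a: "0 < a" and r: "0 < r"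
    and f_uc: "uniformly_continuous_on ({0..a} \<times> cball x0 r) (\<lambda>(t, x). f t x)"
    and w: "kamke_function a w"
    and xi: "0 \<le> \<xi>" "\<xi> \<le> r"
    and f_bdd: "\<forall>t\<in>{0..a}. \<forall>x\<in>cball x0 r. norm (f t x) \<le> \<xi>"
  shows "(convex_mnc \<mu> \<and>
          (\<forall>B. B \<noteq> {} \<and> B \<subseteq> cball x0 r \<longrightarrow>
             (AE t in lebesgue_on {0..min 1 a}. \<mu> (f t ` B) \<le> w t (\<mu> B)))
          \<longrightarrow> (\<exists>x. cauchy_solution f (cball x0 r) x0 (min 1 a) x))
       \<and> (sublinear_mnc \<mu> \<and> \<xi> * a \<le> r \<and>
          (\<forall>B. B \<noteq> {} \<and> B \<subseteq> cball x0 r \<longrightarrow>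
             (AE t in lebesgue_on {0..a}. \<mu> (f t ` B) \<le> w t (\<mu> B)))
          \<longrightarrow> (\<exists>x. cauchy_solution f (cball x0 r) x0 a x))"
proof (intro conjI impI; elim conjE)
  assume mu: "convex_mnc \<mu>" and ae: "\<forall>B. B \<noteq> {} \<and> B \<subseteq> cball x0 r \<longrightarrow>
    (AE t in lebesgue_on {0..min 1 a}. \<mu> (f t ` B) \<le> w t (\<mu> B))"
  have "\<xi> * min 1 a \<le> \<xi> * 1" using xi by (intro mult_left_mono) auto
  hence xi': "\<xi> * min 1 a \<le> r" using xi by simp
  show "\<exists>x. cauchy_solution f (cball x0 r) x0 (min 1 a) x"
  proof (rule Cauchy_solution_if_convex_mnc[OF mu w _ _ _ _ xi(1) xi'])
    show "uniformly_continuous_on ({0..min 1 a} \<times> cball x0 r) (\<lambda>(t, x). f t x)"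
      by (rule uniformly_continuous_on_mono[OF f_uc]) auto
  qed (use a f_bdd ae convex_mnc_scaleR_le[OF mu] in auto)
next
  assume mu: "sublinear_mnc \<mu>" and xi': "\<xi> * a \<le> r" and ae: "\<forall>B. B \<noteq> {} \<and> B \<subseteq> cball x0 r \<longrightarrow>
    (AE t in lebesgue_on {0..a}. \<mu> (f t ` B) \<le> w t (\<mu> B))"
  have "\<mu> (range (\<lambda>i. t *\<^sub>R p i)) \<le> t * \<mu> (range p)" if "0 \<le> t" "bounded (range p)" for t and p :: "nat \<Rightarrow> 'a"
  proof -
    have "\<mu> ((\<lambda>x. t *\<^sub>R x) ` range p) = t * \<mu> (range p)"
      using mu that unfolding sublinear_mnc_def bdd_sets_def by blast
    thus ?thesis by (simp add: image_image)
  qed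
  thus "\<exists>x. cauchy_solution f (cball x0 r) x0 a x"
    by (intro Cauchy_solution_if_convex_mnc[OF convex_mnc_if_sublinear_mnc[OF mu] w a order_refl _ f_uc xi(1) xi'])
      (use f_bdd ae in auto)
qed

end
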